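(* Let $n\geqslant 2$ be an integer, let $a$, $b$ be positive real numbers, and let $f:V_n\to\mathbb{E}^{2n-2}$ be an $n$-dimensional cross-polytope in $\mathbb{E}^{2n-2}$ such that the length of every edge of $f$ is equal to $a$ and the length of every diagonal of $f$ is equal to $b$. Then $f$ is isometric to a homothetic copy of the standard $n$-dimensional cross-polytope $S_n$ in $\mathbb{E}^n$; that is, there is a real number $\lambda>0$ such that $|f(u)-f(v)|=\lambda|u-v|$ for all $u,v\in V_n$. In particular, $b=\sqrt{2}\,a$.
   Context: $\mathbb{E}^k$ denotes Euclidean $k$-space with Euclidean norm $|\cdot|$. Let $\{\mathbf{e}_1,\dots,\mathbf{e}_n\}$ be an orthonormal basis of $\mathbb{E}^n$ and let $V_n=\{\pm\mathbf{e}_1,\dots,\pm\mathbf{e}_n\}$ (a set of $2n$ points). The convex hull of $V_n$ is the standard $n$-dimensional cross-polytope $S_n$, and $V_n$ is its vertex set. For positive integers $n,N$, an $n$-dimensional cross-polytope in $\mathbb{E}^N$ is, by definition, an injective mapping $f:V_n\to\mathbb{E}^N$. For two distinct points $u,v\in V_n$, either $u+v\neq 0$, in which case $u$ and $v$ are joined by an edge of $S_n$ and the segment with endpoints $f(u),f(v)$ is called an edge of $f$, or $u+v=0$, in which case the segment with endpoints $f(u),f(v)$ is called a diagonal of $f$. *)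

theory Defs
  imports "HOL-Analysis.Analysis"
begin

definition orthonormal_basis :: "'a::euclidean_space set \<Rightarrow> bool" where
  "orthonormal_basis B \<longleftrightarrow>
     pairwise orthogonal B \<and> (\<forall>e\<in>B. norm e = 1) \<and> span B = UNIV"

definition cross_vertices :: "'a::real_vector set \<Rightarrow> 'a set" where
  "cross_vertices B = B \<union> uminus ` B"

text \<open>A cross-polytope in a Euclidean space is an injective map on the vertex set of the standard
  one. It is represented by a function on the whole ambient space of which only the
  values on \<open>cross_vertices B\<close> matter.\<close>

definition cross_polytope :: "'a::euclidean_space set \<Rightarrow> ('a \<Rightarrow> 'b::euclidean_space) \<Rightarrow> bool" where
  "cross_polytope B f \<longleftrightarrow> inj_on f (cross_vertices B)"

text \<open>Edges and diagonals are given by the pairs of vertices whose images are their endpoints;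
  both relations are symmetric.\<close>

definition edge_pairs :: "'a::real_vector set \<Rightarrow> ('a \<times> 'a) set" where
  "edge_pairs B =
     {(u, v). u \<in> cross_vertices B \<and> v \<in> cross_vertices B \<and> u \<noteq> v \<and> u + v \<noteq> 0}"

definition diagonal_pairs :: "'a::real_vector set \<Rightarrow> ('a \<times> 'a) set" where
  "diagonal_pairs B =
     {(u, v). u \<in> cross_vertices B \<and> v \<in> cross_vertices B \<and> u \<noteq> v \<and> u + v = 0}"

end

theory Submission imports Defs begin

text \<open>The diagonals of \<open>f\<close> are pairwise orthogonal, and every diagonal is orthogonal to all differences
  of midpoints of diagonals. By Pythagoras, any two midpoints have squared distance
  \<open>a\<^sup>2 - b\<^sup>2 / 2\<close>. If this were positive, then \<open>n\<close> equidistant midpoints would span \<open>n - 1\<close> dimensions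
  orthogonal to the \<open>n\<close> dimensions spanned by the diagonals, which is more than the available
  \<open>2 * n - 2\<close>. Hence all midpoints coincide and \<open>a\<^sup>2 = b\<^sup>2 / 2\<close>.\<close>

text \<open>Given an affine dependence \<open>U\<close>, the weighted sum of the squared distances
  to a point \<open>g\<close> of \<open>M\<close> is computed in two ways. Equidistance turns it
  into a fixed multiple of \<open>U g\<close>, while expanding the squares gives a value free of
  \<open>g\<close>. So \<open>U\<close> is constant on \<open>M\<close>, and having sum zero it
  vanishes.\<close>

lemma equidistant_not_affine_dependent:
  fixes M :: "'a::euclidean_space set"
  assumes fin: "finite M" and c: "c > 0"
    and eq: "\<And>x y. x \<in> M \<Longrightarrow> y \<in> M \<Longrightarrow> x \<noteq> y \<Longrightarrow> dist x y = c"
  shows "\<not> affine_dependent M"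
proof
  assume "affine_dependent M"
  then obtain U where U: "sum U M = 0" "\<exists>v\<in>M. U v \<noteq> 0" "(\<Sum>v\<in>M. U v *\<^sub>R v) = 0"
    unfolding affine_dependent_explicit_finite[OF fin] by blast
  define K where "K = (\<Sum>v\<in>M. U v * (v \<bullet> v))"
  have *: "- (c\<^sup>2 * U g) = K" if g: "g \<in> M" for g
  proof -
    have "(\<Sum>v\<in>M. U v * (dist v g)\<^sup>2) = (\<Sum>v\<in>M - {g}. U v * (dist v g)\<^sup>2)"
      using fin g by (subst sum.remove[of M g]) auto
    also have "\<dots> = (\<Sum>v\<in>M - {g}. U v * c\<^sup>2)"
      using eq g by (intro sum.cong) auto
    also have "\<dots> = - (c\<^sup>2 * U g)"
      using fin g U(1) by (simp add: sum_distrib_right[symmetric] sum_diff1)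
    finally have 1: "(\<Sum>v\<in>M. U v * (dist v g)\<^sup>2) = - (c\<^sup>2 * U g)" .
    \<comment> \<open>After summation over \<open>v\<close> the middle term dies because the
      weighted vector sum is zero, and the last one because the weights sum to zero; only
      \<open>K\<close> remains.\<close>
    have "U v * (dist v g)\<^sup>2 = U v * (v \<bullet> v) - 2 * ((U v *\<^sub>R v) \<bullet> g) + U v * (g \<bullet> g)" for v
      by (simp add: dist_norm power2_norm_eq_inner inner_diff inner_commute algebra_simps)
    then have "(\<Sum>v\<in>M. U v * (dist v g)\<^sup>2) =
        K - 2 * ((\<Sum>v\<in>M. U v *\<^sub>R v) \<bullet> g) + sum U M * (g \<bullet> g)"
      unfolding K_def inner_sum_left
      by (simp add: sum.distrib sum_subtractf sum_distrib_left sum_distrib_right)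
    with 1 U show ?thesis by simp
  qed
  \<comment> \<open>Summing the identity over all \<open>g\<close> in \<open>M\<close> makes the
    left side zero, and \<open>M\<close> is nonempty.\<close>
  have "- (c\<^sup>2 * sum U M) = of_nat (card M) * K"
    using * by (simp add: sum_distrib_left sum_negf[symmetric])
  then have "K = 0"
    using U fin by auto
  with * U(2) c show False by auto
qed

lemma equidistant_dim_differences:
  fixes M :: "'a::euclidean_space set"
  assumes "finite M" "c > 0" "m \<in> M"
    and "\<And>x y. x \<in> M \<Longrightarrow> y \<in> M \<Longrightarrow> x \<noteq> y \<Longrightarrow> dist x y = c"
  shows "dim ((\<lambda>x. x - m) ` (M - {m})) = card M - 1"
proof -
  have "independent ((\<lambda>x. x - m) ` (M - {m}))"
    using equidistant_not_affine_dependent[OF assms(1,2,4)] affine_dependent_iff_dependent2[OF assms(3)]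
    by auto
  moreover have "card ((\<lambda>x. x - m) ` (M - {m})) = card M - 1"
    using assms by (subst card_image) (auto simp: inj_on_def)
  ultimately show ?thesis
    by (simp add: dim_eq_card_independent)
qed

text \<open>The point \<open>x\<close> lies on the perpendicular bisector of \<open>p\<close> and
  \<open>q\<close>. The right side does not involve \<open>x\<close>, so any two such points differ
  by a vector orthogonal to \<open>p - q\<close>.\<close>

lemma inner_diff_if_dist_eq:
  fixes x p q :: "'a::euclidean_space"
  assumes "dist x p = dist x q"
  shows "x \<bullet> (p - q) = (p \<bullet> p - q \<bullet> q) / 2"
proof -
  have "(dist x p)\<^sup>2 = (dist x q)\<^sup>2" using assms by simp
  then show ?thesis
    by (simp add: dist_norm power2_norm_eq_inner inner_diff inner_commute algebra_simps)
qed

lemma orthonormal_basis_card: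
  fixes B :: "'a::euclidean_space set"
  assumes "orthonormal_basis B"
  shows "finite B" "card B = DIM('a)"
proof -
  have "0 \<notin> B" using assms by (force simp: orthonormal_basis_def)
  then have ind: "independent B"
    using assms by (simp add: orthonormal_basis_def pairwise_orthogonal_independent)
  then show "finite B" by (rule independent_imp_finite)
  show "card B = DIM('a)"
    using ind assms dim_eq_card_independent[OF ind] dim_span[of B]
    by (simp add: orthonormal_basis_def)
qed

lemma orthonormal_basis_inner:
  assumes "orthonormal_basis B" "x \<in> B" "y \<in> B"
  shows "x \<bullet> y = (if x = y then 1 else 0)"
  using assms by (auto simp: orthonormal_basis_def pairwise_def orthogonal_def norm_eq_1)

lemma orthonormal_basis_neq_uminus:
  assumes "orthonormal_basis B" "x \<in> B" "y \<in> B"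
  shows "x \<noteq> - y" "- x \<noteq> y"
proof -
  show "x \<noteq> - y"
  proof
    assume "x = - y"
    then have "x \<bullet> y = - (y \<bullet> y)" by simp
    then show False
      using assms by (simp add: orthonormal_basis_inner split: if_splits)
  qed
  then show "- x \<noteq> y" by auto
qed

lemma cross_vertices_inner:
  assumes "orthonormal_basis B" "u \<in> cross_vertices B" "v \<in> cross_vertices B"
  shows "u \<bullet> v = (if u = v then 1 else if u + v = 0 then - 1 else 0)"
proof -
  have inner: "x \<bullet> y = (if x = y then 1 else 0)" if "x \<in> B" "y \<in> B" for x y
    using orthonormal_basis_inner[OF assms(1)] that by blast
  note neg = orthonormal_basis_neq_uminus[OF assms(1)]
  consider x y where "x \<in> B" "y \<in> B" "u = x" "v = y" | x y where "x \<in> B" "y \<in> B" "u = - x" "v = y"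
    | x y where "x \<in> B" "y \<in> B" "u = x" "v = - y" | x y where "x \<in> B" "y \<in> B" "u = - x" "v = - y"
    using assms(2,3) by (auto simp: cross_vertices_def)
  then show ?thesis
    by cases (use inner neg in \<open>force simp: add_eq_0_iff\<close>)+
qed

lemma norm_diff_cross_vertices:
  assumes "orthonormal_basis B" "u \<in> cross_vertices B" "v \<in> cross_vertices B"
  shows "norm (u - v) = (if u = v then 0 else if u + v = 0 then 2 else sqrt 2)"
proof -
  have "(norm (u - v))\<^sup>2 = u \<bullet> u - 2 * (u \<bullet> v) + v \<bullet> v"
    by (simp add: power2_norm_eq_inner inner_diff inner_commute)
  also have "\<dots> = 2 - 2 * (if u = v then 1 else if u + v = 0 then - 1 else 0)"
    by (simp add: cross_vertices_inner[OF assms(1)] assms)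
  finally have "norm (u - v) = sqrt (2 - 2 * (if u = v then 1 else if u + v = 0 then - 1 else 0))"
    by (metis norm_ge_zero real_sqrt_abs abs_of_nonneg)
  then show ?thesis
    by simp
qed

theorem theorem1:
  fixes n :: nat and a b :: real
    and B :: "'a::euclidean_space set"
    and f :: "'a \<Rightarrow> 'b::euclidean_space"
  assumes "n \<ge> 2"
    and "DIM('a) = n"
    and "DIM('b) = 2 * n - 2"
    and "orthonormal_basis B"
    and "a > 0" and "b > 0"
    and "cross_polytope B f"
    and "\<forall>(u, v) \<in> edge_pairs B. dist (f u) (f v) = a"
    and "\<forall>(u, v) \<in> diagonal_pairs B. dist (f u) (f v) = b"
  shows "(\<exists>l>0. \<forall>u \<in> cross_vertices B. \<forall>v \<in> cross_vertices B.
            norm (f u - f v) = l * norm (u - v)) \<and> b = sqrt 2 * a"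
proof -
  note B = assms(4)
  have finB: "finite B" and cardB: "card B = n"
    using orthonormal_basis_card[OF B] assms(2) by auto
  have vert: "e \<in> cross_vertices B" "- e \<in> cross_vertices B" if "e \<in> B" for e
    using that by (auto simp: cross_vertices_def)
  have edge: "dist (f u) (f v) = a"
    if "u \<in> cross_vertices B" "v \<in> cross_vertices B" "u \<noteq> v" "u + v \<noteq> 0" for u v
    using assms(8) that by (auto simp: edge_pairs_def)
  have diag: "dist (f u) (f v) = b"
    if "u \<in> cross_vertices B" "v \<in> cross_vertices B" "u \<noteq> v" "u + v = 0" for u v
    using assms(9) that by (auto simp: diagonal_pairs_def)
  note ne = orthonormal_basis_neq_uminus[OF B]
  \<comment> \<open>Distinct basis vectors with any choice of signs are neither equal nor opposite,
    so all four pairs are edges.\<close>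
  have edgeB: "dist (f e) (f g) = a" "dist (f e) (f (- g)) = a"
      "dist (f (- e)) (f g) = a" "dist (f (- e)) (f (- g)) = a"
    if "e \<in> B" "g \<in> B" "e \<noteq> g" for e g
    using that ne[of e g] ne[of g e] vert
    by (auto intro!: edge simp: add_eq_0_iff)
  \<comment> \<open>Diagonal vector and midpoint: \<open>f e\<close> and \<open>f (- e)\<close> are
    \<open>M e\<close> plus and minus half of \<open>D e\<close>.\<close>
  define D where "D e = f e - f (- e)" for e
  define M where "M e = (1 / 2) *\<^sub>R (f e + f (- e))" for e
  have normD: "norm (D e) = b" if "e \<in> B" for e
    using diag[of e "- e"] vert[OF that] ne[OF that that] by (simp add: D_def dist_norm)
  \<comment> \<open>Both ends of the diagonal at \<open>e\<close> are at distance \<open>a\<close>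
    from both ends of the diagonal at \<open>g\<close>, hence lie on its bisecting
    hyperplane.\<close>
  have bis: "f e \<bullet> D g = (f g \<bullet> f g - f (- g) \<bullet> f (- g)) / 2"
      "f (- e) \<bullet> D g = (f g \<bullet> f g - f (- g) \<bullet> f (- g)) / 2"
    if "e \<in> B" "g \<in> B" "e \<noteq> g" for e g
    unfolding D_def using edgeB[OF that] by (simp_all only: inner_diff_if_dist_eq)
  have DD: "D e \<bullet> D g = 0" if "e \<in> B" "g \<in> B" "e \<noteq> g" for e g
    using bis[OF that] unfolding D_def[of e] inner_diff_left by simp
  \<comment> \<open>The value depends on \<open>g\<close> alone: for \<open>e = g\<close> the
    midpoint lies on the bisector of its own diagonal, and otherwise it is the average of two points
    on that bisector.\<close>
  have MD: "M e \<bullet> D g = (f g \<bullet> f g - f (- g) \<bullet> f (- g)) / 2" if "e \<in> B" "g \<in> B" for e g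
  proof (cases "e = g")
    case True
    then show ?thesis
      by (simp add: M_def D_def inner_diff inner_add inner_commute)
  next
    case False
    with bis[OF that] show ?thesis
      by (simp add: M_def inner_add_left)
  qed
  have MDort: "(M e - M e') \<bullet> D g = 0" if "e \<in> B" "e' \<in> B" "g \<in> B" for e e' g
    by (simp add: inner_diff_left MD[OF that(1,3)] MD[OF that(2,3)])
  have MM: "(dist (M e) (M g))\<^sup>2 = a\<^sup>2 - b\<^sup>2 / 2" if "e \<in> B" "g \<in> B" "e \<noteq> g" for e g
  proof -
    \<comment> \<open>The edge vector \<open>f e - f g\<close> splits into \<open>w\<close>,
      \<open>D e / 2\<close> and \<open>- D g / 2\<close>, which are mutually orthogonal; the last
      two contribute \<open>b\<^sup>2 / 4\<close> each.\<close>
    define w where "w = M e - M g"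
    have "f e = M e + (1 / 2) *\<^sub>R D e" for e
      by (simp add: M_def D_def algebra_simps flip: scaleR_add_left)
    then have "f e - f g = w + (1 / 2) *\<^sub>R (D e - D g)"
      by (simp add: w_def algebra_simps)
    then have "(dist (f e) (f g))\<^sup>2 =
        (w + (1 / 2) *\<^sub>R (D e - D g)) \<bullet> (w + (1 / 2) *\<^sub>R (D e - D g))"
      by (simp only: dist_norm power2_norm_eq_inner)
    moreover have "w \<bullet> D e = 0" "w \<bullet> D g = 0"
      using MDort that by (auto simp: w_def)
    moreover have "D e \<bullet> D e = b\<^sup>2" "D g \<bullet> D g = b\<^sup>2"
      using normD that by (auto simp flip: power2_norm_eq_inner)
    ultimately have "(dist (f e) (f g))\<^sup>2 = w \<bullet> w + b\<^sup>2 / 2"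
      using DD[OF that]
      by (simp add: inner_add inner_diff inner_commute)
    then show ?thesis
      unfolding edgeB(1)[OF that] by (simp add: w_def dist_norm power2_norm_eq_inner)
  qed
  have dimD: "dim (D ` B) = n"
  proof -
    have D0: "D e \<noteq> 0" if "e \<in> B" for e
      using normD[OF that] assms(6) by auto
    have "pairwise orthogonal (D ` B)"
      using DD by (force simp: pairwise_def orthogonal_def)
    with D0 have "independent (D ` B)"
      by (intro pairwise_orthogonal_independent) force+
    \<comment> \<open>Equal diagonal vectors for distinct indices would be orthogonal to themselves,
      hence zero.\<close>
    moreover have "inj_on D B"
      using DD D0 by (metis inj_onI inner_eq_zero_iff)
    ultimately show ?thesis
      by (simp add: dim_eq_card_independent card_image cardB)
  qed
  obtain e where e: "e \<in> B"
    using cardB assms(1) by (metis card.empty ex_in_conv not_numeral_le_zero)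
  have "card (B - {e}) \<noteq> 0"
    using e finB cardB assms(1) by simp
  then obtain g where g: "g \<in> B" "e \<noteq> g"
    by (metis DiffE card.empty ex_in_conv insertCI)
  have ab: "a\<^sup>2 - b\<^sup>2 / 2 = 0"
  proof (rule ccontr)
    assume "a\<^sup>2 - b\<^sup>2 / 2 \<noteq> 0"
    \<comment> \<open>As the squared distance of two midpoints the quantity is nonnegative; the pair
      \<open>e\<close>, \<open>g\<close> exists because \<open>n \<ge> 2\<close>.\<close>
    then have pos: "a\<^sup>2 - b\<^sup>2 / 2 > 0"
      using MM[OF e g] by (metis zero_le_power2 order_le_less)
    define c where "c = sqrt (a\<^sup>2 - b\<^sup>2 / 2)"
    have c: "c > 0" using pos by (simp add: c_def)
    have Mc: "dist (M x) (M y) = c" if "x \<in> B" "y \<in> B" "x \<noteq> y" for x y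
      unfolding c_def MM[OF that, symmetric] by simp
    have "inj_on M B"
      using Mc c by (metis inj_onI dist_self less_irrefl)
    then have cardM: "card (M ` B) = n"
      by (simp add: card_image cardB)
    let ?W = "(\<lambda>x. x - M e) ` (M ` B - {M e})"
    have dimW: "dim ?W = n - 1"
      using equidistant_dim_differences[of "M ` B" c "M e"] finB c e Mc cardM by force
    \<comment> \<open>The two sets are orthogonal, so the dimensions add up to
      \<open>(n - 1) + n = 2 * n - 1\<close>, one more than the space has.\<close>
    have "dim (?W \<union> D ` B) = dim ?W + dim (D ` B)"
      using MDort e by (intro dim_orthogonal_sum) auto
    with dimW dimD dim_subset_UNIV[of "?W \<union> D ` B"] assms(1,3) show False
      by simp
  qed
  have "b\<^sup>2 = (sqrt 2 * a)\<^sup>2"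
    using ab by (simp add: power_mult_distrib)
  then have b: "b = sqrt 2 * a"
    using assms(5,6) by (simp add: power2_eq_iff_nonneg)
  \<comment> \<open>The factor \<open>a / sqrt 2\<close> is read off from the edges, which have
    length \<open>sqrt 2\<close> in the standard polytope; for the diagonals, of length 2 there, it
    gives \<open>sqrt 2 * a = b\<close>.\<close>
  have "norm (f u - f v) = (a / sqrt 2) * norm (u - v)"
    if "u \<in> cross_vertices B" "v \<in> cross_vertices B" for u v
    using edge[OF that] diag[OF that] b real_div_sqrt[of 2]
    by (auto simp: norm_diff_cross_vertices[OF B that] dist_norm field_simps)
  moreover have "a / sqrt 2 > 0"
    using assms(5) by simp
  ultimately show ?thesis
    using b by blast
qed

end
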